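(* Let $f$ be an excursion. Then the function $Jf$ is well-defined and càdlàg on $[-1,1]$. Furthermore: (i) $Jf$ is a PJG excursion such that $d^{\mathsf{L}}_f=d^{\mathsf{L}}_{Jf}$; (ii) $f-Jf$ is a continuous excursion such that $d^{\mathsf{T}}_f=d^{\mathsf{T}}_{f-Jf}$. Moreover, $2d^{\mathsf{L}}_f=d^{\mathsf{V}}_{Jf}$ and $d^{\mathsf{T}}_f=d^{\mathsf{V}}_{f-Jf}$.
   Context: A càdlàg function is right-continuous with left limits. For a càdlàg function $f:[-1,1]\to\mathbb{R}$ write $f(t-)=\lim_{s\to t-}f(s)$, $\Delta_t(f)=f(t)-f(t-)$, and $x_s^t(f)=\mathbf{1}_{\{s\le t\}}\max\big(\inf_{[s,t]}f-f(s-),0\big)$; we drop $f$ from the notation when it is clear. An excursion is a nonnegative càdlàg function $f:[-1,1]\to[0,\infty)$ such that $f(s)=f(1)=0$ for all $s\in[-1,0)$ and $\Delta_t(f)\ge 0$ for all $t\in[0,1]$. For $s\in[0,1]$, $\delta_s$ is the pseudo-distance on $[0,\Delta_s]$ given by $\delta_s(x,y)=\min(|x-y|,\Delta_s-|x-y|)$ (so $\delta_s=0$ if $\Delta_s=0$). For an excursion $f$, define on $[-1,1]^2$: - $d^{\mathsf{L}}_f(s,t)=\sum_{r\in[0,1]}\delta_r(x_r^s,x_r^t)$; - $d^{\mathsf{T}}_f(s,t)=d^{\mathsf{T}}_f(t,s)=f(s)+f(t)-2\inf_{[s,t]}f-\sum_{r\in[0,1]}|x_r^s-x_r^t|$ for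 $s\le t$; - $d^{\mathsf{V}}_f=d^{\mathsf{T}}_f+2d^{\mathsf{L}}_f$. For an excursion $f$, $Jf(t)=\sum_{r\in[0,1]}x_r^t(f)$ for $t\in[-1,1]$ (terms with $r>t$ vanish). An excursion $f$ is called a continuous excursion when $Jf=0$ (equivalently, $f$ is continuous on $[-1,1]$), and a pure jump growth (PJG) excursion when $Jf=f$. *)

theory Defs
  imports "HOL-Analysis.Analysis"
begin

text \<open>
  A function on \<open>[-1,1]\<close> is represented by a total function \<open>real \<Rightarrow> real\<close>; every notion below only
  depends on its values on \<open>[-1,1]\<close>, and equality of functions on \<open>[-1,1]\<close> is stated pointwise there.
  At the end points only the one-sided conditions that make sense inside \<open>[-1,1]\<close> are required.
\<close>

definition cadlag :: "(real \<Rightarrow> real) \<Rightarrow> bool" where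
  "cadlag f \<longleftrightarrow>
     (\<forall>t\<in>{-1..<1}. (f \<longlongrightarrow> f t) (at_right t)) \<and>
     (\<forall>t\<in>{-1<..1}. \<exists>l. (f \<longlongrightarrow> l) (at_left t))"

definition left_lim :: "(real \<Rightarrow> real) \<Rightarrow> real \<Rightarrow> real" where
  "left_lim f t = Lim (at_left t) f"

definition jump :: "(real \<Rightarrow> real) \<Rightarrow> real \<Rightarrow> real" where
  "jump f t = f t - left_lim f t"

text \<open>\<open>xval f s t\<close> is \<open>x\<^sub>s\<^sup>t(f)\<close>.\<close>

definition xval :: "(real \<Rightarrow> real) \<Rightarrow> real \<Rightarrow> real \<Rightarrow> real" where
  "xval f s t = (if s \<le> t then max ((INF u\<in>{s..t}. f u) - left_lim f s) 0 else 0)"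

definition excursion :: "(real \<Rightarrow> real) \<Rightarrow> bool" where
  "excursion f \<longleftrightarrow>
     cadlag f \<and>
     (\<forall>t\<in>{-1..1}. 0 \<le> f t) \<and>
     (\<forall>s\<in>{-1..<0}. f s = 0) \<and> f 1 = 0 \<and>
     (\<forall>t\<in>{0..1}. 0 \<le> jump f t)"

text \<open>
  Sums over \<open>r \<in> [0,1]\<close> are unordered sums of nonnegative reals. Since \<open>infsum\<close> is \<open>0\<close> for a family
  that is not summable, well-definedness of \<open>Jf\<close> is the separate predicate \<open>J_well_defined\<close>. It also
  makes the sums in \<open>d_L\<close> and \<open>d_T\<close> converge, as \<open>\<delta>\<^sub>r(x,y) \<le> \<bar>x - y\<bar> \<le> x + y\<close> for \<open>x, y \<ge> 0\<close>
  and, for an excursion, \<open>x\<^sub>r\<^sup>t \<in> [0,\<Delta>\<^sub>r]\<close>.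
\<close>

definition J_well_defined :: "(real \<Rightarrow> real) \<Rightarrow> bool" where
  "J_well_defined f \<longleftrightarrow> (\<forall>t\<in>{-1..1}. (\<lambda>r. xval f r t) summable_on {0..1})"

definition J :: "(real \<Rightarrow> real) \<Rightarrow> real \<Rightarrow> real" where
  "J f t = (\<Sum>\<^sub>\<infinity>r\<in>{0..1}. xval f r t)"

definition continuous_excursion :: "(real \<Rightarrow> real) \<Rightarrow> bool" where
  "continuous_excursion f \<longleftrightarrow>
     excursion f \<and> J_well_defined f \<and> (\<forall>t\<in>{-1..1}. J f t = 0)"

definition PJG_excursion :: "(real \<Rightarrow> real) \<Rightarrow> bool" where
  "PJG_excursion f \<longleftrightarrow>
     excursion f \<and> J_well_defined f \<and> (\<forall>t\<in>{-1..1}. J f t = f t)"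

text \<open>The circle pseudo-distance, used for \<open>x, y \<in> [0, jump f s]\<close> only.\<close>

definition loop_dist :: "(real \<Rightarrow> real) \<Rightarrow> real \<Rightarrow> real \<Rightarrow> real \<Rightarrow> real" where
  "loop_dist f s x y = min \<bar>x - y\<bar> (jump f s - \<bar>x - y\<bar>)"

definition d_L :: "(real \<Rightarrow> real) \<Rightarrow> real \<Rightarrow> real \<Rightarrow> real" where
  "d_L f s t = (\<Sum>\<^sub>\<infinity>r\<in>{0..1}. loop_dist f r (xval f r s) (xval f r t))"

text \<open>The interval \<open>{min s t..max s t}\<close> incorporates the convention \<open>d_T f s t = d_T f t s\<close>.\<close>

definition d_T :: "(real \<Rightarrow> real) \<Rightarrow> real \<Rightarrow> real \<Rightarrow> real" where
  "d_T f s t = f s + f t - 2 * (INF u\<in>{min s t..max s t}. f u)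
     - (\<Sum>\<^sub>\<infinity>r\<in>{0..1}. \<bar>xval f r s - xval f r t\<bar>)"

definition d_V :: "(real \<Rightarrow> real) \<Rightarrow> real \<Rightarrow> real \<Rightarrow> real" where
  "d_V f s t = d_T f s t + 2 * d_L f s t"

end

theory Submission
  imports Defs
begin

text \<open>
  Let \<open>S(s,t)\<close> be the sum of \<open>x\<^sub>r\<^sup>t\<close> over \<open>r \<le> s\<close>. Each \<open>x\<^sub>r\<^sup>t\<close> is the jump at \<open>r\<close> of the
  nondecreasing function \<open>r \<mapsto> INF {r..t} f\<close>, and comparing such sums of jumps with total increments
  gives, for \<open>s \<le> u \<le> t\<close>,
  \<open>S(s,t) \<le> Jf(u) \<le> S(s,t) + f(u) - INF {s..t} f\<close>.
  Hence the oscillation of \<open>Jf\<close> is at most that of \<open>f\<close>, so \<open>Jf\<close> is cadlag, and its jumps turn out to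
  be those of \<open>f\<close>. Letting \<open>u\<close> approach the infimum of \<open>f\<close> over \<open>{s..t}\<close>, the same sandwich shows that
  \<open>Jf\<close> and \<open>f - Jf\<close> have infima \<open>S(s,t)\<close> and \<open>INF {s..t} f - S(s,t)\<close> there. All identities between
  the distances follow from these two values.
\<close>

section \<open>Partial sums of \<open>J f\<close>, and general facts on sums and limits\<close>

definition J_upto :: "(real \<Rightarrow> real) \<Rightarrow> real \<Rightarrow> real \<Rightarrow> real" where
  "J_upto f s t = (\<Sum>\<^sub>\<infinity>r\<in>{0..s}. xval f r t)"

text \<open>The half-open range leaves out the term at \<open>s\<close>, so that for
  \<open>t = s\<close> this is the left limit of \<open>J f\<close> at \<open>s\<close>.\<close>

definition J_before :: "(real \<Rightarrow> real) \<Rightarrow> real \<Rightarrow> real \<Rightarrow> real" where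
  "J_before f s t = (\<Sum>\<^sub>\<infinity>r\<in>{0..<s}. xval f r t)"

text \<open>Each \<open>c r\<close> is charged to the increment of \<open>\<phi>\<close> from the
  preceding point of \<open>F\<close> to \<open>r\<close>, and these increments do not overlap.
  Comparing \<open>c r\<close> with every earlier \<open>r'\<close> replaces a bound by the jump of
  \<open>\<phi>\<close> at \<open>r\<close>.\<close>

lemma sum_le_mono_on_increment:
  fixes \<phi> c :: "real \<Rightarrow> real"
  assumes fin: "finite F" and sub: "F \<subseteq> {a<..b}" and ab: "a \<le> b"
    and mono: "mono_on {a..b} \<phi>"
    and c: "\<And>r r'. r \<in> F \<Longrightarrow> a \<le> r' \<Longrightarrow> r' < r \<Longrightarrow> c r \<le> \<phi> r - \<phi> r'"
  shows "sum c F \<le> \<phi> b - \<phi> a"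
  using fin sub ab mono c
proof (induction arbitrary: b rule: finite_linorder_max_induct)
  case empty
  then show ?case by (simp add: mono_on_def)
next
  case (insert m A)
  \<comment> \<open>The point just before \<open>m\<close>, or \<open>a\<close> if there is none;
    the induction hypothesis is applied with \<open>k\<close> as right end.\<close>
  define k where "k = Max (insert a A)"
  have k: "k \<in> insert a A" "\<And>r. r \<in> insert a A \<Longrightarrow> r \<le> k"
    unfolding k_def using insert.hyps(1) Max_in[of "insert a A"] by (auto intro: Max_ge)
  have "a \<le> k" "k < m" "m \<le> b"
    using k insert.hyps(2) insert.prems(1) by auto
  have "sum c A \<le> \<phi> k - \<phi> a"
  proof (rule insert.IH)
    show "A \<subseteq> {a<..k}"
    proof
      fix r assume "r \<in> A"
      then show "r \<in> {a<..k}" using k(2)[of r] insert.prems(1) by auto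
    qed
    show "mono_on {a..k} \<phi>"
      using insert.prems(3) by (rule mono_on_subset) (use \<open>k < m\<close> \<open>m \<le> b\<close> in auto)
  qed (use \<open>a \<le> k\<close> insert.prems(4) in auto)
  moreover have "c m \<le> \<phi> m - \<phi> k"
    using insert.prems(4)[of m k] \<open>a \<le> k\<close> \<open>k < m\<close> by auto
  moreover have "\<phi> m \<le> \<phi> b"
    using insert.prems(3) \<open>a \<le> k\<close> \<open>k < m\<close> \<open>m \<le> b\<close> by (auto simp: mono_on_def)
  moreover have "sum c (insert m A) = c m + sum c A"
    using insert.hyps by (intro sum.insert) auto
  ultimately show ?case by simp
qed

lemma
  fixes f g :: "'a \<Rightarrow> real"
  assumes "f summable_on A" "g summable_on A"
  shows summable_on_diff_real: "(\<lambda>x. f x - g x) summable_on A"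
    and infsum_diff_real: "(\<Sum>\<^sub>\<infinity>x\<in>A. f x - g x) = infsum f A - infsum g A"
  using summable_on_add[OF assms(1), of "\<lambda>x. - g x"] infsum_add[OF assms(1), of "\<lambda>x. - g x"] assms(2)
  by (simp_all add: summable_on_uminus infsum_uminus)

lemma xval_nonneg: "0 \<le> xval f r t"
  by (simp add: xval_def)

lemma xval_eq_0: "t < r \<Longrightarrow> xval f r t = 0"
  by (simp add: xval_def)

lemma cadlag_left_lim:
  assumes "cadlag f" "t \<in> {-1<..1}"
  shows "(f \<longlongrightarrow> left_lim f t) (at_left t)"
  using assms unfolding cadlag_def left_lim_def by (metis tendsto_Lim trivial_limit_at_left_real)

lemma left_limI: "(f \<longlongrightarrow> l) (at_left t) \<Longrightarrow> left_lim f t = l" for t :: real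
  unfolding left_lim_def by (rule tendsto_Lim) auto

lemma d_T_commute: "d_T f s t = d_T f t s"
  by (simp add: d_T_def min.commute max.commute abs_minus_commute add.commute)

section \<open>Infima and left limits of an excursion\<close>

context
  fixes f :: "real \<Rightarrow> real"
  assumes exc: "excursion f"
begin

lemma cadlag_exc: "cadlag f" and nonneg_exc: "t \<in> {-1..1} \<Longrightarrow> 0 \<le> f t"
  and zero_exc: "t \<in> {-1..<0} \<Longrightarrow> f t = 0" and final_exc: "f 1 = 0"
  and jump_exc: "t \<in> {0..1} \<Longrightarrow> 0 \<le> jump f t"
  using exc by (auto simp: excursion_def)

lemmas left_lim_exc = cadlag_left_lim[OF cadlag_exc]

lemma bdd_below_exc: "-1 \<le> r \<Longrightarrow> t \<le> 1 \<Longrightarrow> bdd_below (f ` {r..t})"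
  by (rule bdd_belowI[of _ 0]) (auto intro: nonneg_exc)

lemma INF_le: "-1 \<le> r \<Longrightarrow> t \<le> 1 \<Longrightarrow> v \<in> {r..t} \<Longrightarrow> (INF u\<in>{r..t}. f u) \<le> f v"
  by (intro cINF_lower bdd_below_exc)

lemma INF_nonneg: "-1 \<le> r \<Longrightarrow> t \<le> 1 \<Longrightarrow> r \<le> t \<Longrightarrow> 0 \<le> (INF u\<in>{r..t}. f u)"
  by (intro cINF_greatest nonneg_exc) auto

lemma INF_split:
  assumes "-1 \<le> r" "r \<le> s" "s \<le> t" "t \<le> 1"
  shows "(INF u\<in>{r..t}. f u) = min (INF u\<in>{r..s}. f u) (INF u\<in>{s..t}. f u)"
proof -
  have "{r..t} = {r..s} \<union> {s..t}" using assms by auto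
  then show ?thesis
    using assms cINF_union[of "{r..s}" f "{s..t}"] by (simp add: bdd_below_exc inf_min)
qed

lemma left_lim_ge:
  assumes "t \<in> {-1<..1}" "r < t" "\<And>v. v \<in> {r<..<t} \<Longrightarrow> b \<le> f v"
  shows "b \<le> left_lim f t"
  by (rule tendsto_lowerbound[OF left_lim_exc[OF assms(1)] _ trivial_limit_at_left_real])
     (use assms in \<open>auto simp: eventually_at_left_field\<close>)

lemma INF_le_left_lim:
  assumes "-1 \<le> r" "r < s" "s \<le> t" "t \<le> 1"
  shows "(INF u\<in>{r..t}. f u) \<le> left_lim f s"
  using assms by (intro left_lim_ge[where r = r] INF_le) auto

text \<open>The sign condition on jumps covers \<open>{0..1}\<close> only; at negative times
  \<open>f\<close> vanishes to the left, so the left limit is \<open>0\<close>.\<close>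

lemma left_lim_le:
  assumes "t \<in> {-1<..1}"
  shows "left_lim f t \<le> f t"
proof (cases "0 \<le> t")
  case True
  then show ?thesis using jump_exc[of t] assms by (simp add: jump_def)
next
  case False
  have "(f \<longlongrightarrow> 0) (at_left t)"
    by (rule tendsto_eventually)
       (use False assms zero_exc in \<open>auto simp: eventually_at_left_field intro!: exI[of _ "-1"]\<close>)
  then show ?thesis using left_limI nonneg_exc assms by fastforce
qed

section \<open>The values \<open>xval f r t\<close> and their finite sums\<close>

lemma xval_self: "t \<in> {0..1} \<Longrightarrow> xval f t t = jump f t"
  using jump_exc[of t] by (simp add: xval_def jump_def)

lemma xval_antimono:
  assumes "0 \<le> r" "r \<le> s" "s \<le> t" "t \<le> 1"
  shows "xval f r t \<le> xval f r s"
  using INF_split[of r s t] assms by (auto simp: xval_def)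

text \<open>On \<open>{s..t}\<close> the function stays above its left limit at \<open>s\<close>,
  which is at least its infimum over \<open>{r..s}\<close>; so extending the interval from
  \<open>s\<close> to \<open>t\<close> leaves the infimum unchanged.\<close>

lemma xval_eq_if_later_pos:
  assumes "0 \<le> r" "r < s" "s \<le> t" "t \<le> 1" and pos: "0 < xval f s t"
  shows "xval f r t = xval f r s"
proof -
  have "(INF u\<in>{r..s}. f u) \<le> left_lim f s"
    using assms by (intro INF_le_left_lim) auto
  moreover have "left_lim f s < (INF u\<in>{s..t}. f u)"
    using pos assms by (auto simp: xval_def split: if_splits)
  ultimately show ?thesis
    using INF_split[of r s t] assms by (simp add: xval_def)
qed

text \<open>The terms of the sum are dominated by the jumps of the nondecreasing function
  \<open>r \<mapsto> max (INF {r..u} f - INF {s..t} f) 0\<close>, which grows from \<open>0\<close> to \<open>f u - INF {s..t} f\<close>.\<close>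
lemma sum_xval_diff_le:
  assumes F: "finite F" "F \<subseteq> {0..1}" and "-1 \<le> s" "s \<le> u" "u \<le> t" "t \<le> 1"
  shows "(\<Sum>r\<in>F. xval f r u - (if r \<le> s then xval f r t else 0)) \<le> f u - (INF v\<in>{s..t}. f v)"
proof -
  define m where "m = (INF v\<in>{s..t}. f v)"
  define I where "I r = (INF v\<in>{r..u}. f v)" for r
  define c where "c r = xval f r u - (if r \<le> s then xval f r t else 0)" for r
  define \<phi> where "\<phi> r = max (I r - m) 0" for r
  have m: "0 \<le> m" "m \<le> f u"
    unfolding m_def using assms INF_nonneg[of s t] INF_le[of s t u] by auto
  have mono: "I r' \<le> I r" if "-1 \<le> r'" "r' \<le> r" "r \<le> u" for r r'
    unfolding I_def using that assms INF_split[of r' r u] by auto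
  have "sum c F = sum c (F \<inter> {..u})"
    by (rule sum.mono_neutral_right) (use F assms in \<open>auto simp: c_def xval_eq_0\<close>)
  also have "\<dots> \<le> \<phi> u - \<phi> (-1)"
  proof (rule sum_le_mono_on_increment[where \<phi> = \<phi>])
    show "mono_on {-1..u} \<phi>"
      by (rule mono_onI) (use mono in \<open>fastforce simp: \<phi>_def\<close>)
    fix r r' assume r: "r \<in> F \<inter> {..u}" "-1 \<le> r'" "r' < r"
    define p where "p = left_lim f r"
    have "r \<in> {0..u}" using r F by auto
    have I': "I r' \<le> min p (I r)"
      unfolding p_def I_def using r \<open>r \<in> {0..u}\<close> assms mono[of r' r, unfolded I_def]
      by (auto intro!: INF_le_left_lim)
    have xu: "xval f r u = max (I r - p) 0"
      using \<open>r \<in> {0..u}\<close> by (simp add: xval_def I_def p_def)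
    \<comment> \<open>For \<open>r \<le> s\<close>, subtracting \<open>xval f r t\<close> leaves the
      length of the part of the interval from \<open>p\<close> to \<open>I r\<close> above level
      \<open>m\<close>; for \<open>r > s\<close> the whole interval is above \<open>m\<close>. By
      \<open>I'\<close>, \<open>\<phi>\<close> gains at least this length.\<close>
    show "c r \<le> \<phi> r - \<phi> r'"
    proof (cases "r \<le> s")
      case True
      have "(INF v\<in>{r..t}. f v) = min (I r) m"
        using INF_split[of r s t] INF_split[of r s u] INF_split[of s u t] True \<open>r \<in> {0..u}\<close> assms
        unfolding I_def m_def by auto
      then have "xval f r t = max (min (I r) m - p) 0"
        using True assms by (simp add: xval_def p_def)
      then show ?thesis
        using True I' unfolding c_def xu \<phi>_def by auto
    next
      case False
      have "m \<le> p" unfolding m_def p_def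
        using False \<open>r \<in> {0..u}\<close> assms by (intro INF_le_left_lim) auto
      moreover have "m \<le> I r"
        using INF_split[of s r t] INF_split[of r u t] False \<open>r \<in> {0..u}\<close> assms
        unfolding m_def I_def by auto
      ultimately show ?thesis
        using False I' unfolding c_def xu \<phi>_def by auto
    qed
  qed (use F assms in auto)
  also have "\<dots> = f u - m"
  proof -
    \<comment> \<open>The start \<open>-1\<close> lies before every index in \<open>F\<close>, and
      \<open>f\<close> vanishes there, so \<open>\<phi> (-1) = 0\<close>.\<close>
    have "I (-1) \<le> f (-1)" unfolding I_def using assms by (intro INF_le) auto
    then show ?thesis using m zero_exc[of "-1"] by (simp add: \<phi>_def I_def)
  qed
  finally show ?thesis by (simp add: c_def m_def)
qed

text \<open>With \<open>s = -1\<close> no index satisfies \<open>r \<le> s\<close>, so nothing is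
  subtracted. The bound is uniform in \<open>F\<close>, as summability requires.\<close>

lemma sum_xval_le:
  assumes "finite F" "F \<subseteq> {0..1}" "t \<in> {-1..1}"
  shows "(\<Sum>r\<in>F. xval f r t) \<le> f t"
proof -
  have "(\<Sum>r\<in>F. xval f r t) = (\<Sum>r\<in>F. xval f r t - (if r \<le> -1 then xval f r t else 0))"
    using assms by (intro sum.cong) auto
  also have "\<dots> \<le> f t - (INF v\<in>{-1..t}. f v)"
    using assms by (intro sum_xval_diff_le) auto
  also have "\<dots> \<le> f t" using INF_nonneg[of "-1" t] assms by auto
  finally show ?thesis .
qed

section \<open>Summability, the sandwich for \<open>J f\<close>, and the resulting infima\<close>

lemma xval_summable:
  assumes "t \<in> {-1..1}" "A \<subseteq> {0..1}"
  shows "(\<lambda>r. xval f r t) summable_on A"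
proof -
  have "(\<lambda>r. xval f r t) summable_on {0..1}"
    by (rule nonneg_bdd_above_summable_on)
       (auto simp: xval_nonneg bdd_above_def intro: sum_xval_le[OF _ _ assms(1)])
  then show ?thesis using assms(2) by (rule summable_on_subset)
qed

lemma J_nonneg: "0 \<le> J f t"
  unfolding J_def by (intro infsum_nonneg xval_nonneg)

lemma J_le: "t \<in> {-1..1} \<Longrightarrow> J f t \<le> f t"
  unfolding J_def by (intro infsum_le_finite_sums xval_summable sum_xval_le) auto

lemma J_eq_J_upto: "t \<in> {-1..1} \<Longrightarrow> J f t = J_upto f t t"
  unfolding J_def J_upto_def by (rule infsum_cong_neutral) (auto simp: xval_eq_0)

lemma J_upto_eq_J_before:
  assumes "s \<in> {0..1}" "t \<in> {-1..1}"
  shows "J_upto f s t = J_before f s t + xval f s t"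
proof -
  have "{0..s} = insert s {0..<s}" "{0..<s} \<subseteq> {0..1}" using assms by auto
  then show ?thesis
    using assms infsum_insert[OF xval_summable[of t "{0..<s}"], of s]
    unfolding J_upto_def J_before_def by (simp add: assms(2))
qed

lemma J_upto_le_J_before: "s \<le> 1 \<Longrightarrow> t \<in> {-1..1} \<Longrightarrow> r < s \<Longrightarrow> J_upto f r t \<le> J_before f s t"
  unfolding J_upto_def J_before_def
  by (rule infsum_mono_neutral) (auto simp: xval_nonneg intro: xval_summable)

text \<open>Lower half of the sandwich: for \<open>r \<le> s\<close> the values can only decrease
  from time \<open>u\<close> to \<open>t\<close>, and the terms with \<open>r > s\<close> are
  nonnegative.\<close>

lemma J_upto_le_J:
  assumes "-1 \<le> s" "s \<le> u" "u \<le> t" "t \<le> 1"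
  shows "J_upto f s t \<le> J f u"
  unfolding J_upto_def J_def
  by (rule infsum_mono_neutral)
     (use assms in \<open>auto simp: xval_nonneg intro: xval_summable xval_antimono\<close>)

text \<open>An indicator moves the sum to the index set of \<open>J f\<close>, so that the two can
  be subtracted term by term.\<close>

lemma infsum_if_le:
  assumes "s \<le> 1"
  shows "(\<Sum>\<^sub>\<infinity>r\<in>{0..1}. if r \<le> s then xval f r t else 0) = J_upto f s t"
  unfolding J_upto_def using assms by (intro infsum_cong_neutral) auto

lemma summable_if_le:
  assumes "s \<le> 1" "t \<in> {-1..1}"
  shows "(\<lambda>r. if r \<le> s then xval f r t else 0) summable_on {0..1}"
  by (rule summable_on_comparison_test[OF xval_summable[OF assms(2)]]) (auto simp: xval_nonneg)

lemma J_le_J_upto: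
  assumes "-1 \<le> s" "s \<le> u" "u \<le> t" "t \<le> 1"
  shows "J f u \<le> J_upto f s t + (f u - (INF v\<in>{s..t}. f v))"
proof -
  have sums: "(\<lambda>r. xval f r u) summable_on {0..1}"
    "(\<lambda>r. if r \<le> s then xval f r t else 0) summable_on {0..1}"
    using assms by (auto intro!: xval_summable summable_if_le)
  have "J f u - J_upto f s t =
      (\<Sum>\<^sub>\<infinity>r\<in>{0..1}. xval f r u - (if r \<le> s then xval f r t else 0))"
    using infsum_diff_real[OF sums] infsum_if_le[of s t] assms by (simp add: J_def)
  also have "\<dots> \<le> f u - (INF v\<in>{s..t}. f v)"
    using assms by (intro infsum_le_finite_sums summable_on_diff_real sums sum_xval_diff_le) auto
  finally show ?thesis by simp
qed

text \<open>At a \<open>u\<close> where \<open>f\<close> is within \<open>e\<close> of its infimum,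
  the upper half of the sandwich is tight up to \<open>e\<close>. The minimiser is only approximate
  because the infimum may be just a left limit of \<open>f\<close>.\<close>

lemma INF_J:
  assumes "-1 \<le> s" "s \<le> t" "t \<le> 1"
  shows "(INF u\<in>{s..t}. J f u) = J_upto f s t"
proof (rule antisym)
  show "J_upto f s t \<le> (INF u\<in>{s..t}. J f u)"
    using assms by (intro cINF_greatest J_upto_le_J) auto
  show "(INF u\<in>{s..t}. J f u) \<le> J_upto f s t"
  proof (rule field_le_epsilon)
    fix e :: real assume "0 < e"
    then obtain u where u: "u \<in> {s..t}" "f u < (INF v\<in>{s..t}. f v) + e"
      using cInf_lessD[of "f ` {s..t}" "(INF v\<in>{s..t}. f v) + e"] assms by auto
    have "(INF u\<in>{s..t}. J f u) \<le> J f u"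
      using u by (intro cINF_lower bdd_belowI[of _ 0]) (auto simp: J_nonneg)
    then show "(INF u\<in>{s..t}. J f u) \<le> J_upto f s t + e"
      using J_le_J_upto[of s u t] u assms by auto
  qed
qed

text \<open>The halves change roles: the upper one bounds \<open>f - J f\<close> from below
  everywhere, the lower one is used at an approximate minimiser of \<open>f\<close>.\<close>

lemma INF_diff_J:
  assumes "-1 \<le> s" "s \<le> t" "t \<le> 1"
  shows "(INF u\<in>{s..t}. f u - J f u) = (INF u\<in>{s..t}. f u) - J_upto f s t"
proof (rule antisym)
  show "(INF u\<in>{s..t}. f u) - J_upto f s t \<le> (INF u\<in>{s..t}. f u - J f u)"
    using assms J_le_J_upto[of s _ t] by (intro cINF_greatest) (auto simp: algebra_simps)
  show "(INF u\<in>{s..t}. f u - J f u) \<le> (INF u\<in>{s..t}. f u) - J_upto f s t"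
  proof (rule field_le_epsilon)
    fix e :: real assume "0 < e"
    then obtain u where u: "u \<in> {s..t}" "f u < (INF v\<in>{s..t}. f v) + e"
      using cInf_lessD[of "f ` {s..t}" "(INF v\<in>{s..t}. f v) + e"] assms by auto
    have "(INF u\<in>{s..t}. f u - J f u) \<le> f u - J f u"
      using u assms by (intro cINF_lower bdd_belowI[of _ 0]) (auto simp: J_le)
    then show "(INF u\<in>{s..t}. f u - J f u) \<le> (INF u\<in>{s..t}. f u) - J_upto f s t + e"
      using J_upto_le_J[of s u t] u assms by auto
  qed
qed

section \<open>Regularity and jumps of \<open>J f\<close>\<close>

lemma J_oscillation:
  assumes "-1 \<le> s" "s \<le> t" "t \<le> 1" and ab: "\<And>u. u \<in> {s..t} \<Longrightarrow> a \<le> f u \<and> f u \<le> b"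
  shows "\<bar>J f s - J f t\<bar> \<le> b - a"
proof -
  have "a \<le> (INF v\<in>{s..t}. f v)" using assms by (intro cINF_greatest) auto
  \<comment> \<open>The sandwich puts both values in an interval of length \<open>b - a\<close>
    starting at \<open>J_upto f s t\<close>.\<close>
  then show ?thesis
    using J_upto_le_J[of s s t] J_upto_le_J[of s t t] J_le_J_upto[of s s t] J_le_J_upto[of s t t]
      ab[of s] ab[of t] assms(1-3) by (simp add: abs_le_iff)
qed

lemma J_tendsto_right:
  assumes "t \<in> {-1..<1}"
  shows "(J f \<longlongrightarrow> J f t) (at_right t)"
proof (rule tendstoI)
  fix e :: real assume "0 < e"
  \<comment> \<open>A margin \<open>e/3\<close> on either side of \<open>f t\<close> makes the
    oscillation at most \<open>2*e/3 < e\<close>.\<close>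
  then have "\<forall>\<^sub>F u in at_right t. dist (f u) (f t) < e/3"
    using cadlag_exc assms by (intro tendstoD) (auto simp: cadlag_def)
  then obtain b where b: "t < b" "\<And>u. t < u \<Longrightarrow> u < b \<Longrightarrow> dist (f u) (f t) < e/3"
    by (auto simp: eventually_at_right_field)
  have "dist (J f u) (J f t) < e" if "t < u" "u < min b 1" for u
  proof -
    have "f t - e/3 \<le> f v \<and> f v \<le> f t + e/3" if "v \<in> {t..u}" for v
      using b(2)[of v] that \<open>u < min b 1\<close> \<open>0 < e\<close>
      by (cases "v = t") (auto simp: dist_real_def abs_if split: if_splits)
    then have "\<bar>J f t - J f u\<bar> \<le> (f t + e/3) - (f t - e/3)"
      using that assms by (intro J_oscillation) auto
    then show ?thesis using \<open>0 < e\<close> by (auto simp: dist_real_def abs_minus_commute)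
  qed
  then show "\<forall>\<^sub>F u in at_right t. dist (J f u) (J f t) < e"
    using b(1) assms by (auto simp: eventually_at_right_field intro!: exI[of _ "min b 1"])
qed

text \<open>As \<open>u\<close> increases to \<open>t\<close>, \<open>J_upto f u t\<close> exhausts
  \<open>J_before f t t\<close>, and the width of the sandwich for \<open>J f u\<close> over
  \<open>{u..t}\<close> tends to \<open>0\<close>.\<close>

lemma J_tendsto_left:
  assumes t: "t \<in> {-1<..1}"
  shows "(J f \<longlongrightarrow> J_before f t t) (at_left t)"
proof (rule tendstoI)
  fix e :: real assume e: "0 < e"
  define p where "p = left_lim f t"
  have "\<forall>\<^sub>F u in at_left t. dist (f u) p < e/3"
    using left_lim_exc[OF t] e unfolding p_def by (intro tendstoD) auto
  then obtain b where b: "b < t" "\<And>u. b < u \<Longrightarrow> u < t \<Longrightarrow> dist (f u) p < e/3"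
    by (auto simp: eventually_at_left_field)
  have summ: "(\<lambda>r. xval f r t) summable_on {0..<t}"
    using t by (intro xval_summable) auto
  obtain F where F: "finite F" "F \<subseteq> {0..<t}"
      "dist (\<Sum>r\<in>F. xval f r t) (J_before f t t) \<le> e/2"
    using infsum_finite_approximation[OF summ, of "e/2"] e unfolding J_before_def by auto
  \<comment> \<open>Past \<open>a\<close>, \<open>u\<close> exceeds every index in \<open>F\<close>,
    so \<open>J_upto f u t\<close> includes the finite sum, and \<open>f\<close> stays close to
    \<open>p\<close>.\<close>
  define a where "a = Max (insert b (insert (-1) F))"
  have a: "a < t" "b \<le> a" "-1 \<le> a" "\<And>r. r \<in> F \<Longrightarrow> r \<le> a"
    using F(1,2) b(1) t unfolding a_def by (auto simp del: Max_insert intro!: Max_ge)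
  have "dist (J f u) (J_before f t t) < e" if u: "a < u" "u < t" for u
  proof -
    have "(\<Sum>r\<in>F. xval f r t) \<le> J_upto f u t"
      unfolding J_upto_def
      by (rule finite_sum_le_infsum) (use F u a t in \<open>force intro: xval_summable simp: xval_nonneg\<close>)+
    moreover have "J_upto f u t \<le> J f u"
      using u a t by (intro J_upto_le_J) auto
    moreover have "J f u \<le> J_upto f u t + (f u - (INF v\<in>{u..t}. f v))"
      using u a t by (intro J_le_J_upto) auto
    \<comment> \<open>The endpoint \<open>t\<close> belongs to the interval; there
      \<open>f t \<ge> p\<close> because jumps are upward.\<close>
    moreover have "p - e/3 \<le> (INF v\<in>{u..t}. f v)"
    proof (rule cINF_greatest)
      fix v assume "v \<in> {u..t}"
      then show "p - e/3 \<le> f v"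
        using b(2)[of v] u a left_lim_le[OF t] e
        by (cases "v = t") (auto simp: p_def dist_real_def abs_if split: if_splits)
    qed (use u in auto)
    moreover have "f u \<le> p + e/3"
      using b(2)[of u] u a by (auto simp: dist_real_def abs_if split: if_splits)
    moreover have "J_upto f u t \<le> J_before f t t"
      using u t by (intro J_upto_le_J_before) auto
    ultimately show ?thesis
      using F(3) e by (auto simp: dist_real_def)
  qed
  then show "\<forall>\<^sub>F u in at_left t. dist (J f u) (J_before f t t) < e"
    using a(1) by (auto simp: eventually_at_left_field)
qed

lemma cadlag_J: "cadlag (J f)"
  unfolding cadlag_def using J_tendsto_right J_tendsto_left by blast

lemma left_lim_J: "t \<in> {-1<..1} \<Longrightarrow> left_lim (J f) t = J_before f t t"
  by (intro left_limI J_tendsto_left)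

text \<open>The left limit lacks exactly the term \<open>xval f t t\<close>, which is the jump of
  \<open>f\<close>.\<close>

lemma jump_J: "t \<in> {0..1} \<Longrightarrow> jump (J f) t = jump f t"
  using J_eq_J_upto[of t] J_upto_eq_J_before[of t t]
  by (simp add: jump_def left_lim_J xval_self[unfolded jump_def])

lemma J_eq_0: "t \<in> {-1..<0} \<Longrightarrow> J f t = 0"
  unfolding J_def by (intro infsum_0 xval_eq_0) auto

section \<open>\<open>J f\<close> is a PJG excursion\<close>

lemma excursion_J: "excursion (J f)"
  using cadlag_J J_nonneg J_eq_0 J_le[of 1] J_nonneg[of 1] jump_J jump_exc final_exc
  unfolding excursion_def by auto

text \<open>If \<open>xval f s t > 0\<close>, the terms before \<open>s\<close> agree at times
  \<open>s\<close> and \<open>t\<close> and cancel; otherwise they only decrease from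
  \<open>s\<close> to \<open>t\<close>, and the maximum is \<open>0\<close>.\<close>

lemma xval_J:
  assumes "s \<in> {0..1}" "t \<in> {-1..1}"
  shows "xval (J f) s t = xval f s t"
proof (cases "s \<le> t")
  case True
  have *: "xval (J f) s t = max (J_before f s t + xval f s t - J_before f s s) 0"
    using True assms INF_J[of s t] left_lim_J[of s] J_upto_eq_J_before[of s t]
    by (simp add: xval_def)
  show ?thesis
  proof (cases "0 < xval f s t")
    case pos: True
    have "J_before f s t = J_before f s s"
      unfolding J_before_def using pos True assms
      by (intro infsum_cong xval_eq_if_later_pos) auto
    then show ?thesis using * xval_nonneg by simp
  next
    case False
    then have "xval f s t = 0" using xval_nonneg[of f s t] by simp
    moreover have "J_before f s t \<le> J_before f s s"
      unfolding J_before_def using True assms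
      by (intro infsum_mono xval_summable xval_antimono) auto
    ultimately show ?thesis using * by simp
  qed
qed (simp add: xval_def)

lemma J_J: "t \<in> {-1..1} \<Longrightarrow> J (J f) t = J f t"
  unfolding J_def[of "J f"] J_def[of f] by (intro infsum_cong) (simp add: xval_J[unfolded J_def])

lemma J_well_defined_exc: "J_well_defined f"
  unfolding J_well_defined_def by (auto intro: xval_summable)

lemma PJG_excursion_J: "PJG_excursion (J f)"
proof -
  have "J_well_defined (J f)"
    unfolding J_well_defined_def
  proof
    fix t :: real assume "t \<in> {-1..1}"
    then show "(\<lambda>r. xval (J f) r t) summable_on {0..1}"
      using xval_summable[of t "{0..1}"] summable_on_cong[of "{0..1}" "\<lambda>r. xval (J f) r t"] xval_J
      by simp
  qed
  then show ?thesis by (simp add: PJG_excursion_def excursion_J J_J)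
qed

lemma d_L_J:
  assumes "s \<in> {-1..1}" "t \<in> {-1..1}"
  shows "d_L (J f) s t = d_L f s t"
  unfolding d_L_def using assms by (intro infsum_cong) (simp add: xval_J jump_J loop_dist_def)

section \<open>\<open>f - J f\<close> is a continuous excursion\<close>

lemma diff_J_tendsto_left:
  assumes t: "t \<in> {0..1}"
  shows "((\<lambda>t. f t - J f t) \<longlongrightarrow> f t - J f t) (at_left t)"
proof -
  have "((\<lambda>t. f t - J f t) \<longlongrightarrow> left_lim f t - J_before f t t) (at_left t)"
    using t by (intro tendsto_diff left_lim_exc J_tendsto_left) auto
  \<comment> \<open>The equal jumps of \<open>f\<close> and \<open>J f\<close> cancel.\<close>
  moreover have "left_lim f t - J_before f t t = f t - J f t"
    using jump_J[OF t] left_lim_J[of t] t by (simp add: jump_def)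
  ultimately show ?thesis by simp
qed

lemma jump_diff_J: "t \<in> {0..1} \<Longrightarrow> jump (\<lambda>t. f t - J f t) t = 0"
  using left_limI[OF diff_J_tendsto_left] by (simp add: jump_def)

lemma excursion_diff_J: "excursion (\<lambda>t. f t - J f t)"
proof -
  have "cadlag (\<lambda>t. f t - J f t)"
    using cadlag_exc cadlag_J unfolding cadlag_def by (blast intro: tendsto_diff)
  then show ?thesis
    using J_le J_nonneg[of 1] J_le[of 1] zero_exc J_eq_0 final_exc jump_diff_J
    unfolding excursion_def by auto
qed

text \<open>The left limit at \<open>s\<close> is the value at \<open>s\<close>, which the infimum
  over \<open>{s..t}\<close> cannot exceed.\<close>

lemma xval_diff_J:
  assumes "s \<in> {0..1}" "t \<in> {-1..1}"
  shows "xval (\<lambda>t. f t - J f t) s t = 0"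
proof (cases "s \<le> t")
  case True
  have "(INF u\<in>{s..t}. f u - J f u) \<le> f s - J f s"
    using True assms by (intro cINF_lower bdd_belowI[of _ 0]) (auto simp: J_le)
  then show ?thesis
    using left_limI[OF diff_J_tendsto_left[OF assms(1)]] by (simp add: xval_def)
qed (simp add: xval_def)

lemma continuous_excursion_diff_J: "continuous_excursion (\<lambda>t. f t - J f t)"
proof -
  have "(\<lambda>r. xval (\<lambda>t. f t - J f t) r t) summable_on {0..1}" if "t \<in> {-1..1}" for t
    using that summable_on_cong[of "{0..1}" "\<lambda>r. xval (\<lambda>t. f t - J f t) r t" "\<lambda>_. 0"] xval_diff_J
    by simp
  moreover have "J (\<lambda>t. f t - J f t) t = 0" if "t \<in> {-1..1}" for t
    unfolding J_def[of "\<lambda>t. f t - J f t"] using that by (intro infsum_0 xval_diff_J)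
  ultimately show ?thesis
    by (simp add: continuous_excursion_def J_well_defined_def excursion_diff_J)
qed

section \<open>Distances for \<open>J f\<close> and \<open>f - J f\<close>\<close>

lemma infsum_abs_xval_diff:
  assumes "-1 \<le> s" "s \<le> t" "t \<le> 1"
  shows "(\<Sum>\<^sub>\<infinity>r\<in>{0..1}. \<bar>xval f r s - xval f r t\<bar>) = J f s + J f t - 2 * J_upto f s t"
proof -
  have sums: "(\<lambda>r. xval f r s) summable_on {0..1}" "(\<lambda>r. xval f r t) summable_on {0..1}"
    "(\<lambda>r. if r \<le> s then xval f r t else 0) summable_on {0..1}"
    using assms by (auto intro!: xval_summable summable_if_le)
  have "(\<Sum>\<^sub>\<infinity>r\<in>{0..1}. \<bar>xval f r s - xval f r t\<bar>) =
      (\<Sum>\<^sub>\<infinity>r\<in>{0..1}. xval f r s + xval f r t - 2 * (if r \<le> s then xval f r t else 0))"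
    \<comment> \<open>For \<open>r \<le> s\<close> the value decreases from \<open>s\<close> to
      \<open>t\<close>, which fixes the sign; for \<open>r > s\<close> the value at \<open>s\<close>
      is \<open>0\<close>.\<close>
    using assms xval_antimono[of _ s t]
    by (intro infsum_cong) (auto simp: xval_nonneg xval_eq_0)
  also have "\<dots> = J f s + J f t - 2 * J_upto f s t"
    using sums assms by (simp only: infsum_diff_real infsum_add infsum_cmult_right' infsum_if_le
        summable_on_add summable_on_cmult_right J_def)
  finally show ?thesis .
qed

text \<open>For \<open>s \<le> t\<close> the sum of absolute differences is
  \<open>J f s + J f t - 2 * J_upto f s t\<close>, and by \<open>INF_J\<close> so is the expression
  it is subtracted from.\<close>

lemma d_T_J:
  assumes "s \<in> {-1..1}" "t \<in> {-1..1}"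
  shows "d_T (J f) s t = 0"
proof -
  have *: "d_T (J f) s t = 0" if "s \<in> {-1..1}" "t \<in> {-1..1}" "s \<le> t" for s t
  proof -
    have "(\<Sum>\<^sub>\<infinity>r\<in>{0..1}. \<bar>xval (J f) r s - xval (J f) r t\<bar>) = J f s + J f t - 2 * J_upto f s t"
      using that infsum_abs_xval_diff[of s t]
      by (subst infsum_cong[of _ _ "\<lambda>r. \<bar>xval f r s - xval f r t\<bar>"]) (auto simp: xval_J)
    then show ?thesis using that by (simp add: d_T_def INF_J)
  qed
  show ?thesis
    using *[of s t] *[of t s] assms d_T_commute[of "J f" s t] by linarith
qed

text \<open>For \<open>f - J f\<close> the sum of absolute differences vanishes, but by
  \<open>INF_diff_J\<close> the remaining terms drop by
  \<open>J f s + J f t - 2 * J_upto f s t\<close>, which is that sum for \<open>f\<close>.\<close>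

lemma d_T_diff_J:
  assumes "s \<in> {-1..1}" "t \<in> {-1..1}"
  shows "d_T (\<lambda>t. f t - J f t) s t = d_T f s t"
proof -
  have *: "d_T (\<lambda>t. f t - J f t) s t = d_T f s t" if "s \<in> {-1..1}" "t \<in> {-1..1}" "s \<le> t" for s t
  proof -
    have "(\<Sum>\<^sub>\<infinity>r\<in>{0..1}. \<bar>xval (\<lambda>t. f t - J f t) r s - xval (\<lambda>t. f t - J f t) r t\<bar>) = 0"
      using that by (intro infsum_0) (simp add: xval_diff_J)
    then show ?thesis
      using that by (simp add: d_T_def INF_diff_J infsum_abs_xval_diff)
  qed
  show ?thesis
    using *[of s t] *[of t s] assms d_T_commute[of f s t] d_T_commute[of "\<lambda>t. f t - J f t" s t]
    by linarith
qed

lemma d_L_diff_J: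
  assumes "s \<in> {-1..1}" "t \<in> {-1..1}"
  shows "d_L (\<lambda>t. f t - J f t) s t = 0"
  unfolding d_L_def using assms by (intro infsum_0) (simp add: xval_diff_J jump_diff_J loop_dist_def)

end

theorem theorem1p3:
  fixes f :: "real \<Rightarrow> real"
  assumes "excursion f"
  shows "J_well_defined f \<and> cadlag (J f) \<and>
    (PJG_excursion (J f) \<and>
      (\<forall>s\<in>{-1..1}. \<forall>t\<in>{-1..1}. d_L f s t = d_L (J f) s t)) \<and>
    (continuous_excursion (\<lambda>t. f t - J f t) \<and>
      (\<forall>s\<in>{-1..1}. \<forall>t\<in>{-1..1}. d_T f s t = d_T (\<lambda>t. f t - J f t) s t)) \<and>
    (\<forall>s\<in>{-1..1}. \<forall>t\<in>{-1..1}. 2 * d_L f s t = d_V (J f) s t) \<and>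
    (\<forall>s\<in>{-1..1}. \<forall>t\<in>{-1..1}. d_T f s t = d_V (\<lambda>t. f t - J f t) s t)"
  using J_well_defined_exc[OF assms] cadlag_J[OF assms] PJG_excursion_J[OF assms]
    continuous_excursion_diff_J[OF assms] d_L_J[OF assms] d_T_J[OF assms]
    d_T_diff_J[OF assms] d_L_diff_J[OF assms]
  by (simp add: d_V_def)

end
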